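(* Let $\kappa$ be a regular uncountable cardinal such that $\kappa^{<\kappa} = \kappa$, and let $G \leqslant \operatorname{Sym}(\kappa)$ be a subgroup of the symmetric group on $\kappa$. Then $G$ satisfies the $\kappa^{+}$-compatibility condition.
   Context: For a regular uncountable cardinal $\kappa$ with $\kappa^{<\kappa}=\kappa$, a group $G$ satisfies the $\kappa^{+}$-compatibility condition if the following holds. Whenever $H$ is a group with $|H| < \kappa$ and $(f_i \mid i < \kappa^{+})$ is a sequence of embeddings $f_i : H \to G$, with $H_i = f_i[H]$, there exist ordinals $i < j < \kappa^{+}$ and a surjective homomorphism $\varphi : \langle H_i, H_j \rangle \to H_i$ such that $\varphi \circ f_j = f_i$ and $\varphi \upharpoonright H_i = \mathrm{id}_{H_i}$. *)

theory Defs
  imports "HOL-Algebra.Bij" "HOL-Algebra.Elementary_Groups"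
begin

unbundle cardinal_syntax

text \<open>
  An infinite cardinal \<open>\<kappa>\<close> is a relation \<open>k\<close> with \<open>Card_order k\<close> (a well-order on
  \<open>Field k\<close> of minimal order type); the elements of \<open>Field k\<close> are the ordinals below \<open>\<kappa>\<close>,
  and \<open>underS k a\<close> is the set of ordinals below \<open>a\<close>.
\<close>

text \<open>
  \<open>\<kappa>\<close> to the power \<open><\<kappa>\<close>: the number of sequences of length \<open>a < \<kappa>\<close> with values in \<open>\<kappa>\<close>.
  A sequence is tagged with its length, because functions with different domains
  need not be distinct as total functions in HOL.
\<close>

definition cexp_less_self :: "'k rel \<Rightarrow> ('k \<times> ('k \<Rightarrow> 'k)) rel" where
  "cexp_less_self k = |SIGMA a : Field k. Func (underS k a) (Field k)|"

text \<open>
  The \<open>\<kappa>\<^sup>+\<close>-compatibility condition, for test groups \<open>H\<close> with elements in the type \<open>'h\<close>.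
  HOL cannot quantify over types inside a definition, so \<open>'h\<close> is an explicit type
  parameter; a statement about all \<open>H\<close> keeps \<open>'h\<close> as a free type variable.
\<close>

definition compatibility_condition ::
  "'h itself \<Rightarrow> 'k rel \<Rightarrow> ('g, 'm) monoid_scheme \<Rightarrow> bool" where
  "compatibility_condition (T :: 'h itself) k G \<longleftrightarrow>
    (\<forall>(H :: 'h monoid) (f :: 'k set \<Rightarrow> 'h \<Rightarrow> 'g).
      group H \<and> |carrier H| <o k \<and> (\<forall>i \<in> Field (cardSuc k). f i \<in> mon H G) \<longrightarrow>
      (\<exists>i j \<phi>. (i, j) \<in> cardSuc k \<and> i \<noteq> j \<and>
        \<phi> \<in> epi (subgroup_generated G (f i ` carrier H \<union> f j ` carrier H))
                 (G\<lparr>carrier := f i ` carrier H\<rparr>) \<and>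
        (\<forall>h \<in> carrier H. \<phi> (f j h) = f i h) \<and>
        (\<forall>x \<in> f i ` carrier H. \<phi> x = x)))"

end

theory Submission
  imports Defs
begin

text \<open>
  A subgroup of \<open>Sym(\<kappa>)\<close> acts on \<open>\<kappa>\<close>, and an embedded copy of a group \<open>H\<close> of size \<open><\<kappa>\<close>
  already acts faithfully on some invariant set \<open>A \<subseteq> \<kappa>\<close> of size \<open><\<kappa>\<close>: choose for every
  \<open>h \<in> H\<close> a point \<open>s h\<close>, moved by \<open>h\<close> if \<open>h \<noteq> 1\<close>, and let \<open>A\<close> be the union of the orbits of
  these points. The set \<open>A\<close> together with the action of \<open>H\<close> on it can be read off from the table
  \<open>(u, h) \<mapsto> u \<cdot> s h\<close>: its values are the elements of \<open>A\<close>, and \<open>v\<close> takes \<open>u \<cdot> s h\<close> to the entry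
  at \<open>(v u, h)\<close>. The table is a function from \<open>H \<times> H\<close>, a set of size \<open><\<kappa>\<close>, to \<open>\<kappa>\<close>, and
  \<open>\<kappa>\<^bsup><\<kappa>\<^esup> = \<kappa>\<close> allows at most \<open>\<kappa>\<close> such tables. So two among \<open>\<kappa>\<^sup>+\<close> embeddings, \<open>f\<^sub>i\<close> and
  \<open>f\<^sub>j\<close>, have the same table (lemma \<open>pigeonhole_small_tables\<close>) and therefore act identically on
  a common set \<open>A\<close>.

  Every element of \<open>\<langle>H\<^sub>i, H\<^sub>j\<rangle>\<close> then acts on \<open>A\<close> as some element of \<open>H\<^sub>i\<close>, and that element is
  unique because \<open>H\<^sub>i\<close> acts faithfully on \<open>A\<close>. Sending each element of \<open>\<langle>H\<^sub>i, H\<^sub>j\<rangle>\<close> to the element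
  of \<open>H\<^sub>i\<close> with the same action on \<open>A\<close> is the required retraction
  (lemma \<open>retraction_if_agree_on_faithful_invariant_set\<close>).
\<close>

section \<open>Counting functions on small sets\<close>

lemma ordLess_card_of_inj_underS:
  assumes "Well_order k" and "|S| <o k"
  obtains a e where "a \<in> Field k" and "inj_on e S" and "e ` S \<subseteq> underS k a"
proof -
  obtain a where a: "a \<in> Field k" "|S| =o Restr k (underS k a)"
    using ordLess_iff_ordIso_Restr[OF assms(1) card_of_Well_order] assms(2) by blast
  then obtain e where "BNF_Wellorder_Embedding.iso |S| (Restr k (underS k a)) e"
    unfolding ordIso_def by blast
  then have "bij_betw e S (Field (Restr k (underS k a)))"
    unfolding BNF_Wellorder_Embedding.iso_def Field_card_of by simp
  moreover have "Field (Restr k (underS k a)) \<subseteq> underS k a"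
    by (auto simp: Field_def)
  ultimately show thesis
    using that[OF a(1), of e] by (auto simp: bij_betw_def)
qed

lemma card_of_square_ordLess:
  assumes k: "Card_order k" "\<not> finite (Field k)" and S: "|S| <o k"
  shows "|S \<times> S| <o k"
proof (cases "finite S")
  case True
  then have "|S \<times> S| <o |Field k|"
    using k(2) by (intro finite_ordLess_infinite) (auto simp: Field_card_of card_of_well_order_on)
  then show ?thesis
    using card_of_Field_ordIso[OF k(1)] by (rule ordLess_ordIso_trans)
next
  case False
  then show ?thesis
    using card_of_Times_same_infinite S by (blast intro: ordIso_ordLess_trans)
qed

text \<open>
  An injection of \<open>S\<close> into an initial segment of \<open>\<kappa>\<close> turns functions from \<open>S\<close> to \<open>\<kappa>\<close> into
  sequences of a fixed length below \<open>\<kappa>\<close>, of which \<open>\<kappa>\<^bsup><\<kappa>\<^esup> = \<kappa>\<close> leaves only \<open>\<kappa>\<close> many.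
\<close>

lemma pigeonhole_small_tables:
  fixes k :: "'k rel" and F :: "'k set \<Rightarrow> 's \<Rightarrow> 'k"
  assumes k: "Card_order k" and exp: "cexp_less_self k =o k"
    and S: "|S| <o k"
    and F: "\<And>i x. i \<in> Field (cardSuc k) \<Longrightarrow> x \<in> S \<Longrightarrow> F i x \<in> Field k"
  obtains i j where "(i, j) \<in> cardSuc k" and "i \<noteq> j" and "\<And>x. x \<in> S \<Longrightarrow> F i x = F j x"
proof -
  have wo: "Well_order k"
    using k by (rule Card_order_wo_rel[THEN wo_rel.WELL])
  obtain a e where a: "a \<in> Field k" and e: "inj_on e S" "e ` S \<subseteq> underS k a"
    by (rule ordLess_card_of_inj_underS[OF wo S])
  \<comment> \<open>Positions outside the range of \<open>e\<close> get an arbitrary value below \<open>\<kappa>\<close>; here \<open>a\<close> itself.\<close>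
  define T where "T i = (a, \<lambda>y. if y \<in> underS k a
      then if y \<in> e ` S then F i (inv_into S e y) else a else undefined)" for i
  have range: "T ` Field (cardSuc k) \<subseteq> (SIGMA b : Field k. Func (underS k b) (Field k))"
    using a F by (auto simp: T_def Func_def inv_into_f_f[OF e(1)])
  have "\<not> inj_on T (Field (cardSuc k))"
  proof
    assume "inj_on T (Field (cardSuc k))"
    then have "|Field (cardSuc k)| \<le>o cexp_less_self k"
      unfolding cexp_less_self_def using range by (auto simp: card_of_ordLeq[symmetric])
    then have "|Field (cardSuc k)| \<le>o k"
      using exp by (rule ordLeq_ordIso_trans)
    then have "cardSuc k \<le>o k"
      using card_of_Field_ordIso[OF cardSuc_Card_order[OF k]]
      by (metis ordIso_ordLeq_trans ordIso_symmetric)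
    then show False
      using cardSuc_greater[OF k] not_ordLess_ordLeq by blast
  qed
  then obtain i j where ij: "i \<in> Field (cardSuc k)" "j \<in> Field (cardSuc k)" "T i = T j" "i \<noteq> j"
    unfolding inj_on_def by blast
  have eq: "F i x = F j x" if "x \<in> S" for x
  proof -
    have "e x \<in> underS k a"
      using e(2) that by blast
    then show ?thesis
      using fun_cong[OF arg_cong[OF ij(3), of snd], of "e x"] that
      by (simp add: T_def inv_into_f_f[OF e(1)])
  qed
  have "Total (cardSuc k)"
    using Card_order_wo_rel[OF cardSuc_Card_order[OF k]] wo_rel.TOTAL by blast
  then have "(i, j) \<in> cardSuc k \<or> (j, i) \<in> cardSuc k"
    using ij unfolding total_on_def by blast
  then show thesis
    using that[of i j] that[of j i] ij(4) eq by metis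
qed

section \<open>Groups of permutations agreeing on an invariant set\<close>

lemma BijGroup_mult_apply:
  assumes "x \<in> Bij X" and "y \<in> Bij X" and "a \<in> X"
  shows "(x \<otimes>\<^bsub>BijGroup X\<^esub> y) a = x (y a)"
  using assms by (simp add: BijGroup_def compose_eq)

lemma hom_BijGroup_apply:
  assumes G: "subgroup G (BijGroup X)" and f: "f \<in> hom H ((BijGroup X)\<lparr>carrier := G\<rparr>)"
    and "u \<in> carrier H" and "v \<in> carrier H" and "a \<in> X"
  shows "f (u \<otimes>\<^bsub>H\<^esub> v) a = f u (f v a)"
proof -
  have "f u \<in> Bij X" "f v \<in> Bij X"
    using hom_in_carrier[OF f] assms subgroup.subset[OF G] by (auto simp: BijGroup_def)
  then show ?thesis
    using hom_mult[OF f] assms by (simp add: BijGroup_mult_apply)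
qed

lemma hom_BijGroup_one_apply:
  assumes G: "subgroup G (BijGroup X)" and f: "f \<in> hom H ((BijGroup X)\<lparr>carrier := G\<rparr>)"
    and H: "group H" and "a \<in> X"
  shows "f \<one>\<^bsub>H\<^esub> a = a"
proof -
  have "group ((BijGroup X)\<lparr>carrier := G\<rparr>)"
    using G group_BijGroup by (rule subgroup.subgroup_is_group)
  then have "f \<one>\<^bsub>H\<^esub> = \<one>\<^bsub>BijGroup X\<^esub>"
    using hom_one[OF f H] by simp
  then show ?thesis
    using assms by (simp add: BijGroup_def)
qed

text \<open>
  Agreement of an element of the permutation group with an element of the image of \<open>f\<close>
  on the invariant set \<open>A\<close> is preserved by products and inverses. It therefore extends from
  the generators, where it is the assumption, to the generated subgroup; and faithfulness of
  \<open>f\<close> on \<open>A\<close> makes it a homomorphism into the image of \<open>f\<close>.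
\<close>

lemma retraction_if_agree_on_faithful_invariant_set:
  fixes G :: "('x \<Rightarrow> 'x) set" and X :: "'x set" and H :: "('h, 'm) monoid_scheme"
  defines "K \<equiv> (BijGroup X)\<lparr>carrier := G\<rparr>"
  assumes G: "subgroup G (BijGroup X)" and H: "group H"
    and f: "f \<in> hom H K" and g: "g \<in> hom H K"
    and A: "A \<subseteq> X"
    and invariant: "\<And>h a. h \<in> carrier H \<Longrightarrow> a \<in> A \<Longrightarrow> f h a \<in> A"
    and faithful: "\<And>h. h \<in> carrier H \<Longrightarrow> (\<And>a. a \<in> A \<Longrightarrow> f h a = a) \<Longrightarrow> h = \<one>\<^bsub>H\<^esub>"
    and agree: "\<And>h a. h \<in> carrier H \<Longrightarrow> a \<in> A \<Longrightarrow> g h a = f h a"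
  obtains \<phi> where
    "\<phi> \<in> epi (subgroup_generated K (f ` carrier H \<union> g ` carrier H)) (K\<lparr>carrier := f ` carrier H\<rparr>)"
    and "\<And>h. h \<in> carrier H \<Longrightarrow> \<phi> (g h) = f h"
    and "\<And>x. x \<in> f ` carrier H \<Longrightarrow> \<phi> x = x"
proof -
  interpret H: group H by (rule H)
  have K: "group K"
    unfolding K_def using G group_BijGroup by (rule subgroup.subgroup_is_group)
  interpret K: group K by (rule K)
  note f' = f[unfolded K_def]
  have fmult: "f (u \<otimes>\<^bsub>H\<^esub> v) a = f u (f v a)" if "u \<in> carrier H" "v \<in> carrier H" "a \<in> A" for u v a
    using hom_BijGroup_apply[OF G f'] that A by blast
  have fone: "f \<one>\<^bsub>H\<^esub> a = a" if "a \<in> A" for a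
    using hom_BijGroup_one_apply[OF G f' H] that A by blast
  have Kmult: "(x \<otimes>\<^bsub>K\<^esub> y) a = x (y a)" if "x \<in> carrier K" "y \<in> carrier K" "a \<in> A" for x y a
    using that A subgroup.subset[OF G] BijGroup_mult_apply[of x X y a]
    by (auto simp: K_def BijGroup_def)
  have Kone: "\<one>\<^bsub>K\<^esub> a = a" if "a \<in> A" for a
    using that A by (auto simp: K_def BijGroup_def)
  have fK: "f h \<in> carrier K" and gK: "g h \<in> carrier K" if "h \<in> carrier H" for h
    using that f g by (auto simp: hom_def)

  let ?S = "f ` carrier H \<union> g ` carrier H"
  let ?L = "generate K ?S"
  have S: "?S \<subseteq> carrier K"
    using fK gK by blast
  have L: "carrier (subgroup_generated K ?S) = ?L"
    unfolding carrier_subgroup_generated using S by (simp add: Int_absorb1)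
  have LK: "?L \<subseteq> carrier K"
    using K.generate_incl[OF S] .

  have unique: "u = v"
    if u: "u \<in> carrier H" and v: "v \<in> carrier H" and eq: "\<And>a. a \<in> A \<Longrightarrow> f u a = f v a" for u v
  proof -
    have "inv\<^bsub>H\<^esub> u \<otimes>\<^bsub>H\<^esub> v = \<one>\<^bsub>H\<^esub>"
    proof (rule faithful)
      show "inv\<^bsub>H\<^esub> u \<otimes>\<^bsub>H\<^esub> v \<in> carrier H"
        using u v by simp
      show "f (inv\<^bsub>H\<^esub> u \<otimes>\<^bsub>H\<^esub> v) a = a" if a: "a \<in> A" for a
      proof -
        have "f (inv\<^bsub>H\<^esub> u \<otimes>\<^bsub>H\<^esub> v) a = f (inv\<^bsub>H\<^esub> u) (f u a)"
          using u v a by (simp add: fmult eq)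
        also have "\<dots> = f (inv\<^bsub>H\<^esub> u \<otimes>\<^bsub>H\<^esub> u) a"
          using u a by (metis fmult H.inv_closed)
        finally have "f (inv\<^bsub>H\<^esub> u \<otimes>\<^bsub>H\<^esub> v) a = f (inv\<^bsub>H\<^esub> u \<otimes>\<^bsub>H\<^esub> u) a" .
        then show ?thesis
          using u a by (simp add: fone)
      qed
    qed
    then show ?thesis
      using u v by (metis H.inv_closed H.inv_equality H.inv_inv)
  qed

  have ex: "\<exists>h \<in> carrier H. \<forall>a \<in> A. x a = f h a" if "x \<in> ?L" for x
    using that
  proof (induction rule: generate.induct)
    case one
    then show ?case
      using fone Kone by (intro bexI[of _ "\<one>\<^bsub>H\<^esub>"]) auto
  next
    case (incl x)
    then show ?case
      using agree by auto
  next
    case (inv x)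
    then obtain h where h: "h \<in> carrier H" "\<forall>a \<in> A. x a = f h a"
      using agree by auto
    have x: "x \<in> carrier K"
      using inv S by blast
    have "(inv\<^bsub>K\<^esub> x) a = f (inv\<^bsub>H\<^esub> h) a" if a: "a \<in> A" for a
    proof -
      let ?b = "f (inv\<^bsub>H\<^esub> h) a"
      have b: "?b \<in> A"
        using invariant h(1) a by simp
      have "x ?b = f (h \<otimes>\<^bsub>H\<^esub> inv\<^bsub>H\<^esub> h) a"
        using h a b by (metis fmult H.inv_closed)
      then have "x ?b = a"
        using h a by (simp add: fone)
      then have "(inv\<^bsub>K\<^esub> x) a = (inv\<^bsub>K\<^esub> x \<otimes>\<^bsub>K\<^esub> x) ?b"
        using x b by (metis Kmult K.inv_closed)
      then show ?thesis
        using x b by (simp add: Kone)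
    qed
    then show ?case
      using h(1) by blast
  next
    case (eng x y)
    then obtain u v where uv: "u \<in> carrier H" "\<forall>a \<in> A. x a = f u a"
      "v \<in> carrier H" "\<forall>a \<in> A. y a = f v a"
      by blast
    have "(x \<otimes>\<^bsub>K\<^esub> y) a = f (u \<otimes>\<^bsub>H\<^esub> v) a" if a: "a \<in> A" for a
    proof -
      have "(x \<otimes>\<^bsub>K\<^esub> y) a = x (y a)"
        using Kmult eng.hyps LK a by blast
      also have "\<dots> = f u (f v a)"
        using uv a invariant by simp
      also have "\<dots> = f (u \<otimes>\<^bsub>H\<^esub> v) a"
        using fmult uv(1,3) a by simp
      finally show ?thesis .
    qed
    then show ?case
      using uv by (intro bexI[of _ "u \<otimes>\<^bsub>H\<^esub> v"]) auto
  qed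

  define \<rho> where "\<rho> x = (SOME h. h \<in> carrier H \<and> (\<forall>a \<in> A. x a = f h a))" for x
  have \<rho>: "\<rho> x \<in> carrier H" "\<And>a. a \<in> A \<Longrightarrow> x a = f (\<rho> x) a" if "x \<in> ?L" for x
  proof -
    have "\<rho> x \<in> carrier H \<and> (\<forall>a \<in> A. x a = f (\<rho> x) a)"
      unfolding \<rho>_def by (rule someI_ex) (use ex[OF that] in blast)
    then show "\<rho> x \<in> carrier H" "\<And>a. a \<in> A \<Longrightarrow> x a = f (\<rho> x) a"
      by auto
  qed
  have \<rho>_eq: "\<rho> x = h" if "x \<in> ?L" "h \<in> carrier H" "\<And>a. a \<in> A \<Longrightarrow> x a = f h a" for x h
    using unique[of "\<rho> x" h] \<rho>[OF that(1)] that by simp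
  have \<rho>f: "\<rho> (f h) = h" and \<rho>g: "\<rho> (g h) = h" if "h \<in> carrier H" for h
    using that agree by (auto intro!: \<rho>_eq intro: generate.incl)
  have \<rho>mult: "\<rho> (x \<otimes>\<^bsub>K\<^esub> y) = \<rho> x \<otimes>\<^bsub>H\<^esub> \<rho> y" if xy: "x \<in> ?L" "y \<in> ?L" for x y
  proof (rule \<rho>_eq)
    show "x \<otimes>\<^bsub>K\<^esub> y \<in> ?L"
      using xy by (rule generate.eng)
    show "\<rho> x \<otimes>\<^bsub>H\<^esub> \<rho> y \<in> carrier H"
      using xy \<rho>(1) by simp
    show "(x \<otimes>\<^bsub>K\<^esub> y) a = f (\<rho> x \<otimes>\<^bsub>H\<^esub> \<rho> y) a" if a: "a \<in> A" for a
    proof -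
      have "(x \<otimes>\<^bsub>K\<^esub> y) a = x (y a)"
        using Kmult xy LK a by blast
      also have "\<dots> = f (\<rho> x) (f (\<rho> y) a)"
        using \<rho>(2)[OF xy(2) a] \<rho>(2)[OF xy(1) invariant[OF \<rho>(1)[OF xy(2)] a]] by simp
      also have "\<dots> = f (\<rho> x \<otimes>\<^bsub>H\<^esub> \<rho> y) a"
        using fmult[OF \<rho>(1)[OF xy(1)] \<rho>(1)[OF xy(2)] a] by simp
      finally show ?thesis .
    qed
  qed
  have "(\<lambda>x. f (\<rho> x)) \<in> epi (subgroup_generated K ?S) (K\<lparr>carrier := f ` carrier H\<rparr>)"
    unfolding epi_def hom_def mem_Collect_eq L
  proof (intro conjI ballI)
    show "(\<lambda>x. f (\<rho> x)) \<in> ?L \<rightarrow> carrier (K\<lparr>carrier := f ` carrier H\<rparr>)"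
      using \<rho>(1) by auto
    show "f (\<rho> (x \<otimes>\<^bsub>subgroup_generated K ?S\<^esub> y))
        = f (\<rho> x) \<otimes>\<^bsub>K\<lparr>carrier := f ` carrier H\<rparr>\<^esub> f (\<rho> y)"
      if "x \<in> ?L" "y \<in> ?L" for x y
      using that \<rho>mult \<rho>(1) hom_mult[OF f] by simp
    show "(\<lambda>x. f (\<rho> x)) ` ?L = carrier (K\<lparr>carrier := f ` carrier H\<rparr>)"
    proof
      show "carrier (K\<lparr>carrier := f ` carrier H\<rparr>) \<subseteq> (\<lambda>x. f (\<rho> x)) ` ?L"
        by (auto intro!: image_eqI[of "f _" _ "f _"] simp: \<rho>f intro: generate.incl)
    qed (use \<rho>(1) in auto)
  qed
  then show thesis
    by (rule that) (auto simp: \<rho>f \<rho>g)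
qed

section \<open>The compatibility condition\<close>

theorem proposition1p11:
  fixes k :: "'k rel" and G :: "('k \<Rightarrow> 'k) set"
  assumes "Card_order k" and "natLeq <o k" and "regularCard k"
    and "cexp_less_self k =o k"
    and "subgroup G (BijGroup (Field k))"
  shows "compatibility_condition TYPE('h) k ((BijGroup (Field k))\<lparr>carrier := G\<rparr>)"
  unfolding compatibility_condition_def
proof (intro allI impI, elim conjE)
  let ?X = "Field k"
  let ?K = "(BijGroup ?X)\<lparr>carrier := G\<rparr>"
  fix H :: "'h monoid" and f :: "'k set \<Rightarrow> 'h \<Rightarrow> 'k \<Rightarrow> 'k"
  assume H: "group H" and small: "|carrier H| <o k"
    and mon: "\<forall>i \<in> Field (cardSuc k). f i \<in> mon H ?K"
  interpret H: group H by (rule H)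
  note G = assms(5)
  have hom: "f i \<in> hom H ?K" and inj: "inj_on (f i) (carrier H)"
    if "i \<in> Field (cardSuc k)" for i
    using mon that by (auto simp: mon_def)
  have Bij: "f i h \<in> Bij ?X" if "i \<in> Field (cardSuc k)" "h \<in> carrier H" for i h
    using hom_in_carrier[OF hom] that subgroup.subset[OF G] by (auto simp: BijGroup_def)
  have app: "f i h a \<in> ?X" if "i \<in> Field (cardSuc k)" "h \<in> carrier H" "a \<in> ?X" for i h a
    using Bij_imp_funcset[OF Bij] that by blast

  have inf: "\<not> finite ?X"
    using cinfinite_mono[OF ordLess_imp_ordLeq[OF assms(2)] natLeq_cinfinite]
    by (simp add: cinfinite_def)
  then obtain z where z: "z \<in> ?X"
    by fastforce
  have moved: "\<exists>a \<in> ?X. h \<noteq> \<one>\<^bsub>H\<^esub> \<longrightarrow> f i h a \<noteq> a"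
    if i: "i \<in> Field (cardSuc k)" and h: "h \<in> carrier H" for i h
  proof (rule ccontr)
    assume "\<not> ?thesis"
    then have ne: "h \<noteq> \<one>\<^bsub>H\<^esub>" and "\<And>a. a \<in> ?X \<Longrightarrow> f i h a = a"
      using z by auto
    then have "f i h = f i \<one>\<^bsub>H\<^esub>"
      using hom_BijGroup_one_apply[OF G hom[OF i] H] Bij[OF i h] Bij[OF i H.one_closed]
      by (intro extensionalityI[of _ ?X]) (auto simp: Bij_def)
    then show False
      using inj[OF i] h ne by (auto dest: inj_onD)
  qed
  define s where "s i h = (SOME a. a \<in> ?X \<and> (h \<noteq> \<one>\<^bsub>H\<^esub> \<longrightarrow> f i h a \<noteq> a))" for i h
  have s: "s i h \<in> ?X" "h \<noteq> \<one>\<^bsub>H\<^esub> \<Longrightarrow> f i h (s i h) \<noteq> s i h"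
    if "i \<in> Field (cardSuc k)" "h \<in> carrier H" for i h
    using someI_ex[of "\<lambda>a. a \<in> ?X \<and> (h \<noteq> \<one>\<^bsub>H\<^esub> \<longrightarrow> f i h a \<noteq> a)"] moved[OF that]
    unfolding s_def by blast+

  define F where "F i = (\<lambda>(u, h). f i u (s i h))" for i
  have "|carrier H \<times> carrier H| <o k"
    by (rule card_of_square_ordLess[OF assms(1) inf small])
  moreover have "F i x \<in> ?X" if "i \<in> Field (cardSuc k)" "x \<in> carrier H \<times> carrier H" for i x
    using that s(1) app by (auto simp: F_def)
  ultimately obtain i j where ij: "(i, j) \<in> cardSuc k" "i \<noteq> j"
    and table: "\<And>x. x \<in> carrier H \<times> carrier H \<Longrightarrow> F i x = F j x"
    using pigeonhole_small_tables[OF assms(1,4), of "carrier H \<times> carrier H" F] by blast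
  have i: "i \<in> Field (cardSuc k)" and j: "j \<in> Field (cardSuc k)"
    using ij(1) by (auto intro: FieldI1 FieldI2)
  \<comment> \<open>The row of the table at the neutral element contains the chosen points themselves.\<close>
  have F: "f i u (s i h) = f j u (s i h)" if "u \<in> carrier H" "h \<in> carrier H" for u h
  proof -
    have "s i h = s j h"
      using table[of "(\<one>\<^bsub>H\<^esub>, h)"] that s(1) i j
      by (simp add: F_def hom_BijGroup_one_apply[OF G hom H])
    then show ?thesis
      using table[of "(u, h)"] that by (simp add: F_def)
  qed

  define A where "A = (\<lambda>(u, h). f i u (s i h)) ` (carrier H \<times> carrier H)"
  have mult_i: "f i v (f i u (s i h)) = f i (v \<otimes>\<^bsub>H\<^esub> u) (s i h)"
    and mult_j: "f j v (f j u (s i h)) = f j (v \<otimes>\<^bsub>H\<^esub> u) (s i h)"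
    if "u \<in> carrier H" "v \<in> carrier H" "h \<in> carrier H" for u v h
    using that s(1)[OF i] hom_BijGroup_apply[OF G hom] i j by simp_all
  have sA: "s i h \<in> A" if "h \<in> carrier H" for h
    unfolding A_def
    by (rule image_eqI[of _ _ "(\<one>\<^bsub>H\<^esub>, h)"])
       (use that s(1)[OF i] hom_BijGroup_one_apply[OF G hom[OF i] H] in auto)
  obtain \<phi> where
    "\<phi> \<in> epi (subgroup_generated ?K (f i ` carrier H \<union> f j ` carrier H))
       (?K\<lparr>carrier := f i ` carrier H\<rparr>)"
    "\<And>h. h \<in> carrier H \<Longrightarrow> \<phi> (f j h) = f i h"
    "\<And>x. x \<in> f i ` carrier H \<Longrightarrow> \<phi> x = x"
  proof (rule retraction_if_agree_on_faithful_invariant_set[OF G H hom[OF i] hom[OF j], of A])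
    show "A \<subseteq> ?X"
      using s(1) app i by (auto simp: A_def)
    show "f i h a \<in> A" if "h \<in> carrier H" "a \<in> A" for h a
    proof -
      obtain u h' where u: "u \<in> carrier H" "h' \<in> carrier H" and a: "a = f i u (s i h')"
        using \<open>a \<in> A\<close> by (auto simp: A_def)
      have "f i h a = f i (h \<otimes>\<^bsub>H\<^esub> u) (s i h')"
        using u that by (simp add: a mult_i)
      then show ?thesis
        unfolding A_def using u that by (intro image_eqI[of _ _ "(h \<otimes>\<^bsub>H\<^esub> u, h')"]) auto
    qed
    show "h = \<one>\<^bsub>H\<^esub>" if "h \<in> carrier H" "\<And>a. a \<in> A \<Longrightarrow> f i h a = a" for h
      using s(2)[OF i that(1)] that(2)[OF sA[OF that(1)]] by blast
    show "f j h a = f i h a" if h: "h \<in> carrier H" and a: "a \<in> A" for h a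
    proof -
      obtain u h' where u: "u \<in> carrier H" "h' \<in> carrier H" and a': "a = f i u (s i h')"
        using a by (auto simp: A_def)
      have "f j h a = f j (h \<otimes>\<^bsub>H\<^esub> u) (s i h')"
        using u h by (simp add: a' F mult_j)
      also have "\<dots> = f i (h \<otimes>\<^bsub>H\<^esub> u) (s i h')"
        using u h F by simp
      also have "\<dots> = f i h a"
        using u h by (simp add: a' mult_i)
      finally show ?thesis .
    qed
  qed blast
  then show "\<exists>i j \<phi>. (i, j) \<in> cardSuc k \<and> i \<noteq> j \<and>
      \<phi> \<in> epi (subgroup_generated ?K (f i ` carrier H \<union> f j ` carrier H))
        (?K\<lparr>carrier := f i ` carrier H\<rparr>) \<and>
      (\<forall>h \<in> carrier H. \<phi> (f j h) = f i h) \<and> (\<forall>x \<in> f i ` carrier H. \<phi> x = x)"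
    using ij by blast
qed

end
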